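(* The proof system $\mathsf{SDELKh}$ is complete over the class of all models: for every formula $\varphi\in\mathbf{DELKh}$, if $M,w\vDash\varphi$ for every model $M$ and every world $w$ of $M$, then $\varphi$ is provable in $\mathsf{SDELKh}$.
   Context: Fix a countable set $\mathbf{P}$ of proposition letters. $\mathbf{PL}$: $\alpha::=p\mid\bot\mid(\alpha\land\alpha)\mid(\alpha\lor\alpha)\mid(\alpha\to\alpha)$, $p\in\mathbf{P}$. $\mathbf{DELKh}$: $\varphi::=p\mid\bot\mid(\varphi\land\varphi)\mid(\varphi\lor\varphi)\mid(\varphi\to\varphi)\mid\mathsf{K}\varphi\mid\mathsf{Kh}\alpha\mid\Box\varphi$, with $p\in\mathbf{P}$, $\alpha\in\mathbf{PL}$. Abbreviations: $\neg\varphi:=\varphi\to\bot$, $\varphi\leftrightarrow\psi:=(\varphi\to\psi)\land(\psi\to\varphi)$, $\widehat{\mathsf{K}}:=\neg\mathsf{K}\neg$, $\Diamond:=\neg\Box\neg$. A model (epistemic model) is $M=\langle W,V\rangle$ with $W\ne\varnothing$ and $V:W\to\wp(\mathbf{P})$. A submodel of $M$ is $\langle W',V|_{W'}\rangle$ with $\varnothing\ne W'\subseteq W$. Resolution space: $S(p)=\{p\}$; $S(\bot)=\{\bot\}$; $S(\alpha\lor\beta)=(S(\alpha)\times\{0\})\cup(S(\beta)\times\{1\})$; $S(\alpha\land\beta)=S(\alpha)\times S(\beta)$; $S(\alpha\to\beta)=S(\beta)^{S(\alpha)}$. Resolutions at $w\in W$: $R(w,\bot)=\varnothing$; $R(w,p)=\{p\}$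 if $p\in V(w)$, else $\varnothing$; $R(w,\alpha\lor\beta)=(R(w,\alpha)\times\{0\})\cup(R(w,\beta)\times\{1\})$; $R(w,\alpha\land\beta)=R(w,\alpha)\times R(w,\beta)$; $R(w,\alpha\to\beta)=\{f\in S(\beta)^{S(\alpha)}\mid f[R(w,\alpha)]\subseteq R(w,\beta)\}$. Satisfaction $M,w\vDash\varphi$: $M,w\nvDash\bot$; $M,w\vDash p$ iff $p\in V(w)$; $\land,\lor,\to$ are classical; $M,w\vDash\Box\varphi$ iff $M',w\vDash\varphi$ for every submodel $M'$ of $M$ containing $w$; $M,w\vDash\mathsf{K}\varphi$ iff $M,v\vDash\varphi$ for all $v\in W$; $M,w\vDash\mathsf{Kh}\alpha$ iff there is $x\in S(\alpha)$ with $x\in R(v,\alpha)$ for all $v\in W$. System $\mathsf{SDELKh}$ ($p\in\mathbf{P}$; $\alpha,\beta,\alpha_i\in\mathbf{PL}$; $\varphi,\psi\in\mathbf{DELKh}$). Axioms: all (instances in $\mathbf{DELKh}$ of) propositional tautologies; $\mathsf{K}(\varphi\to\psi)\to(\mathsf{K}\varphi\to\mathsf{K}\psi)$; $\mathsf{K}\varphi\to\varphi$; $\mathsf{K}\varphi\to\mathsf{K}\mathsf{K}\varphi$; $\neg\mathsf{K}\varphi\to\mathsf{K}\neg\mathsf{K}\varphi$; $\Box(\varphi\to\psi)\to(\Box\varphi\to\Box\psi)$; $\Box\varphi\to\varphi$; $\Box\varphi\to\Box\Box\varphi$; $\mathsf{K}\Box\varphi\to\Box\mathsf{K}\varphi$;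 $\alpha\to\Box\alpha$; $\alpha\to\Diamond\mathsf{Kh}\alpha$; $\mathsf{Kh}\alpha\to\mathsf{K}\alpha$; $\mathsf{K}p\to\mathsf{Kh}p$; $\mathsf{Kh}\bot\leftrightarrow\bot$; $\mathsf{Kh}(\alpha\lor\beta)\leftrightarrow\mathsf{Kh}\alpha\lor\mathsf{Kh}\beta$; $\mathsf{Kh}(\alpha\land\beta)\leftrightarrow\mathsf{Kh}\alpha\land\mathsf{Kh}\beta$; $\mathsf{Kh}(\alpha\to\beta)\leftrightarrow\mathsf{K}\Box(\mathsf{Kh}\alpha\to\mathsf{Kh}\beta)$; $\mathsf{Kh}\alpha\to\mathsf{K}\mathsf{Kh}\alpha$; $\neg\mathsf{Kh}\alpha\to\mathsf{K}\neg\mathsf{Kh}\alpha$; and for each $k\in\mathbb{N}$, $\alpha\land\bigwedge_{1\le i\le k}\widehat{\mathsf{K}}(\alpha\land\alpha_i)\to\Diamond(\mathsf{K}\alpha\land\bigwedge_{1\le i\le k}\widehat{\mathsf{K}}\alpha_i)$. Rules: modus ponens; from $\vdash\varphi$ infer $\vdash\mathsf{K}\varphi$; from $\vdash\varphi$ infer $\vdash\Box\varphi$. *)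

theory Defs
  imports Main "HOL-Library.FSet" "HOL-Library.Countable" "HOL-Library.FuncSet"
begin

datatype 'p pl =
    PAtom 'p
  | PBot
  | PAnd "'p pl" "'p pl"
  | POr "'p pl" "'p pl"
  | PImp "'p pl" "'p pl"

datatype 'p delkh =
    Atom 'p
  | Bot  (\<open>\<^bold>\<bottom>\<close>)
  | And "'p delkh" "'p delkh"  (infixr \<open>\<^bold>\<and>\<close> 75)
  | Or "'p delkh" "'p delkh"  (infixr \<open>\<^bold>\<or>\<close> 70)
  | Imp "'p delkh" "'p delkh"  (infixr \<open>\<^bold>\<longrightarrow>\<close> 65)
  | K "'p delkh"
  | Kh "'p pl"
  | Box "'p delkh"

abbreviation Neg :: "'p delkh \<Rightarrow> 'p delkh" where
  "Neg \<phi> \<equiv> \<phi> \<^bold>\<longrightarrow> \<^bold>\<bottom>"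

abbreviation Iff :: "'p delkh \<Rightarrow> 'p delkh \<Rightarrow> 'p delkh"  (infix \<open>\<^bold>\<longleftrightarrow>\<close> 60) where
  "\<phi> \<^bold>\<longleftrightarrow> \<psi> \<equiv> (\<phi> \<^bold>\<longrightarrow> \<psi>) \<^bold>\<and> (\<psi> \<^bold>\<longrightarrow> \<phi>)"

abbreviation Khat :: "'p delkh \<Rightarrow> 'p delkh" where
  "Khat \<phi> \<equiv> Neg (K (Neg \<phi>))"

abbreviation Dia :: "'p delkh \<Rightarrow> 'p delkh" where
  "Dia \<phi> \<equiv> Neg (Box (Neg \<phi>))"

(* The conjunction of a one-element list is that formula itself; the empty conjunction is
   Neg Bot. *)
fun Conj :: "'p delkh list \<Rightarrow> 'p delkh" where
  "Conj [] = Neg \<^bold>\<bottom>"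
| "Conj [\<phi>] = \<phi>"
| "Conj (\<phi> # \<psi> # \<chi>s) = \<phi> \<^bold>\<and> Conj (\<psi> # \<chi>s)"

primrec pl_subst :: "('q \<Rightarrow> 'p delkh) \<Rightarrow> 'q pl \<Rightarrow> 'p delkh" where
  "pl_subst \<sigma> (PAtom q) = \<sigma> q"
| "pl_subst \<sigma> PBot = \<^bold>\<bottom>"
| "pl_subst \<sigma> (PAnd \<alpha> \<beta>) = pl_subst \<sigma> \<alpha> \<^bold>\<and> pl_subst \<sigma> \<beta>"
| "pl_subst \<sigma> (POr \<alpha> \<beta>) = pl_subst \<sigma> \<alpha> \<^bold>\<or> pl_subst \<sigma> \<beta>"
| "pl_subst \<sigma> (PImp \<alpha> \<beta>) = pl_subst \<sigma> \<alpha> \<^bold>\<longrightarrow> pl_subst \<sigma> \<beta>"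

(* The inclusion of PL in DELKh. *)
abbreviation of_pl :: "'p pl \<Rightarrow> 'p delkh" where
  "of_pl \<equiv> pl_subst Atom"

primrec pl_eval :: "('q \<Rightarrow> bool) \<Rightarrow> 'q pl \<Rightarrow> bool" where
  "pl_eval v (PAtom q) \<longleftrightarrow> v q"
| "pl_eval v PBot \<longleftrightarrow> False"
| "pl_eval v (PAnd \<alpha> \<beta>) \<longleftrightarrow> pl_eval v \<alpha> \<and> pl_eval v \<beta>"
| "pl_eval v (POr \<alpha> \<beta>) \<longleftrightarrow> pl_eval v \<alpha> \<or> pl_eval v \<beta>"
| "pl_eval v (PImp \<alpha> \<beta>) \<longleftrightarrow> (pl_eval v \<alpha> \<longrightarrow> pl_eval v \<beta>)"

definition tautology :: "'q pl \<Rightarrow> bool" where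
  "tautology \<alpha> \<longleftrightarrow> (\<forall>v. pl_eval v \<alpha>)"

(* Only the values of val on worlds are relevant. Worlds are drawn from a type 'w, so validity
   over all models is relative to 'w; for 'w with only finitely many elements it can be weaker
   than validity over all models. *)
record ('w, 'p) model =
  worlds :: "'w set"
  val :: "'w \<Rightarrow> 'p set"

definition epistemic_model :: "('w, 'p) model \<Rightarrow> bool" where
  "epistemic_model M \<longleftrightarrow> worlds M \<noteq> {}"

definition submodel :: "('w, 'p) model \<Rightarrow> ('w, 'p) model \<Rightarrow> bool" where
  "submodel M' M \<longleftrightarrow> worlds M' \<noteq> {} \<and> worlds M' \<subseteq> worlds M \<and>
     (\<forall>w\<in>worlds M'. val M' w = val M w)"

(* Resolutions of formulas of all shapes live in one type. RInl x and RInr x stand for the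
   pairs (x,0) and (x,1). RFun F is the function with graph F; all resolution spaces are
   finite (res_space_finite below), so finite graphs suffice. *)
datatype 'p res =
    RAtom 'p
  | RBot
  | RInl "'p res"
  | RInr "'p res"
  | RPair "'p res" "'p res"
  | RFun "('p res \<times> 'p res) fset"

definition graph_fun :: "'p res set \<Rightarrow> 'p res set \<Rightarrow> ('p res \<times> 'p res) fset \<Rightarrow> bool" where
  "graph_fun A B F \<longleftrightarrow> fset F \<subseteq> A \<times> B \<and> (\<forall>x\<in>A. \<exists>!y. (x, y) \<in> fset F)"

primrec res_space :: "'p pl \<Rightarrow> 'p res set" where
  "res_space (PAtom p) = {RAtom p}"
| "res_space PBot = {RBot}"
| "res_space (PAnd \<alpha> \<beta>) = {RPair x y |x y. x \<in> res_space \<alpha> \<and> y \<in> res_space \<beta>}"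
| "res_space (POr \<alpha> \<beta>) = RInl ` res_space \<alpha> \<union> RInr ` res_space \<beta>"
| "res_space (PImp \<alpha> \<beta>) = {RFun F |F. graph_fun (res_space \<alpha>) (res_space \<beta>) F}"

primrec resolutions :: "('w, 'p) model \<Rightarrow> 'w \<Rightarrow> 'p pl \<Rightarrow> 'p res set" where
  "resolutions M w (PAtom p) = (if p \<in> val M w then {RAtom p} else {})"
| "resolutions M w PBot = {}"
| "resolutions M w (PAnd \<alpha> \<beta>) =
     {RPair x y |x y. x \<in> resolutions M w \<alpha> \<and> y \<in> resolutions M w \<beta>}"
| "resolutions M w (POr \<alpha> \<beta>) = RInl ` resolutions M w \<alpha> \<union> RInr ` resolutions M w \<beta>"
| "resolutions M w (PImp \<alpha> \<beta>) =
     {RFun F |F. graph_fun (res_space \<alpha>) (res_space \<beta>) F \<and>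
        (\<forall>(x, y)\<in>fset F. x \<in> resolutions M w \<alpha> \<longrightarrow> y \<in> resolutions M w \<beta>)}"

primrec sat :: "('w, 'p) model \<Rightarrow> 'w \<Rightarrow> 'p delkh \<Rightarrow> bool"  (\<open>(_, _ \<Turnstile> _)\<close> [51, 51, 51] 50) where
  "M, w \<Turnstile> Atom p \<longleftrightarrow> p \<in> val M w"
| "M, w \<Turnstile> \<^bold>\<bottom> \<longleftrightarrow> False"
| "M, w \<Turnstile> \<phi> \<^bold>\<and> \<psi> \<longleftrightarrow> M, w \<Turnstile> \<phi> \<and> M, w \<Turnstile> \<psi>"
| "M, w \<Turnstile> \<phi> \<^bold>\<or> \<psi> \<longleftrightarrow> M, w \<Turnstile> \<phi> \<or> M, w \<Turnstile> \<psi>"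
| "M, w \<Turnstile> \<phi> \<^bold>\<longrightarrow> \<psi> \<longleftrightarrow> (M, w \<Turnstile> \<phi> \<longrightarrow> M, w \<Turnstile> \<psi>)"
| "M, w \<Turnstile> K \<phi> \<longleftrightarrow> (\<forall>v\<in>worlds M. M, v \<Turnstile> \<phi>)"
| "M, w \<Turnstile> Kh \<alpha> \<longleftrightarrow> (\<exists>x\<in>res_space \<alpha>. \<forall>v\<in>worlds M. x \<in> resolutions M v \<alpha>)"
| "M, w \<Turnstile> Box \<phi> \<longleftrightarrow> (\<forall>M'. submodel M' M \<and> w \<in> worlds M' \<longrightarrow> M', w \<Turnstile> \<phi>)"

(* In Taut the letters of the tautology are the schematic letters nat rather than 'p, which
   may be finite and then has too few letters. *)
inductive SDELKh :: "'p delkh \<Rightarrow> bool"  (\<open>\<turnstile> _\<close> [50] 50) where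
  Taut: "tautology (\<alpha> :: nat pl) \<Longrightarrow> \<turnstile> pl_subst \<sigma> \<alpha>"
| DistK: "\<turnstile> K (\<phi> \<^bold>\<longrightarrow> \<psi>) \<^bold>\<longrightarrow> (K \<phi> \<^bold>\<longrightarrow> K \<psi>)"
| TK: "\<turnstile> K \<phi> \<^bold>\<longrightarrow> \<phi>"
| FourK: "\<turnstile> K \<phi> \<^bold>\<longrightarrow> K (K \<phi>)"
| FiveK: "\<turnstile> Neg (K \<phi>) \<^bold>\<longrightarrow> K (Neg (K \<phi>))"
| DistBox: "\<turnstile> Box (\<phi> \<^bold>\<longrightarrow> \<psi>) \<^bold>\<longrightarrow> (Box \<phi> \<^bold>\<longrightarrow> Box \<psi>)"
| TBox: "\<turnstile> Box \<phi> \<^bold>\<longrightarrow> \<phi>"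
| FourBox: "\<turnstile> Box \<phi> \<^bold>\<longrightarrow> Box (Box \<phi>)"
| KBox: "\<turnstile> K (Box \<phi>) \<^bold>\<longrightarrow> Box (K \<phi>)"
| PersPL: "\<turnstile> of_pl \<alpha> \<^bold>\<longrightarrow> Box (of_pl \<alpha>)"
| DiaKh: "\<turnstile> of_pl \<alpha> \<^bold>\<longrightarrow> Dia (Kh \<alpha>)"
| KhK: "\<turnstile> Kh \<alpha> \<^bold>\<longrightarrow> K (of_pl \<alpha>)"
| KhAtom: "\<turnstile> K (Atom p) \<^bold>\<longrightarrow> Kh (PAtom p)"
| KhBot: "\<turnstile> Kh PBot \<^bold>\<longleftrightarrow> \<^bold>\<bottom>"
| KhOr: "\<turnstile> Kh (POr \<alpha> \<beta>) \<^bold>\<longleftrightarrow> Kh \<alpha> \<^bold>\<or> Kh \<beta>"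
| KhAnd: "\<turnstile> Kh (PAnd \<alpha> \<beta>) \<^bold>\<longleftrightarrow> Kh \<alpha> \<^bold>\<and> Kh \<beta>"
| KhImp: "\<turnstile> Kh (PImp \<alpha> \<beta>) \<^bold>\<longleftrightarrow> K (Box (Kh \<alpha> \<^bold>\<longrightarrow> Kh \<beta>))"
| FourKh: "\<turnstile> Kh \<alpha> \<^bold>\<longrightarrow> K (Kh \<alpha>)"
| FiveKh: "\<turnstile> Neg (Kh \<alpha>) \<^bold>\<longrightarrow> K (Neg (Kh \<alpha>))"
| Update: "\<turnstile> of_pl \<alpha> \<^bold>\<and> Conj (map (\<lambda>\<beta>. Khat (of_pl \<alpha> \<^bold>\<and> of_pl \<beta>)) \<beta>s)
     \<^bold>\<longrightarrow> Dia (K (of_pl \<alpha>) \<^bold>\<and> Conj (map (\<lambda>\<beta>. Khat (of_pl \<beta>)) \<beta>s))"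
| MP: "\<turnstile> \<phi> \<^bold>\<longrightarrow> \<psi> \<Longrightarrow> \<turnstile> \<phi> \<Longrightarrow> \<turnstile> \<psi>"
| NecK: "\<turnstile> \<phi> \<Longrightarrow> \<turnstile> K \<phi>"
| NecBox: "\<turnstile> \<phi> \<Longrightarrow> \<turnstile> Box \<phi>"

lemma finite_graph_fun:
  assumes "finite A" "finite B"
  shows "finite {F. graph_fun A B F}"
proof -
  have "fset ` {F. graph_fun A B F} \<subseteq> Pow (A \<times> B)"
    by (auto simp: graph_fun_def)
  then have "finite (fset ` {F. graph_fun A B F})"
    by (rule finite_subset) (simp add: assms)
  then show ?thesis
    by (rule finite_imageD) (auto simp: inj_on_def fset_inject)
qed

lemma res_space_finite: "finite (res_space \<alpha>)"
proof (induction \<alpha>)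
  case (PAnd \<alpha> \<beta>)
  have "res_space (PAnd \<alpha> \<beta>) = (\<lambda>(x, y). RPair x y) ` (res_space \<alpha> \<times> res_space \<beta>)"
    by auto
  then show ?case using PAnd by simp
next
  case (PImp \<alpha> \<beta>)
  have "res_space (PImp \<alpha> \<beta>) = RFun ` {F. graph_fun (res_space \<alpha>) (res_space \<beta>) F}"
    by auto
  then show ?case using finite_graph_fun[OF PImp] by (metis finite_imageI)
qed auto

(* The implication clause of res_space is the full function space. *)
lemma res_space_PImp_bij:
  "bij_betw (\<lambda>f. RFun (Abs_fset ((\<lambda>x. (x, f x)) ` res_space \<alpha>)))
     (res_space \<alpha> \<rightarrow>\<^sub>E res_space \<beta>) (res_space (PImp \<alpha> \<beta>))"
proof -
  let ?A = "res_space \<alpha>" and ?B = "res_space \<beta>"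
  let ?g = "\<lambda>f. (\<lambda>x. (x, f x)) ` ?A"
  have fs: "fset (Abs_fset (?g f)) = ?g f" for f :: "'a res \<Rightarrow> 'a res"
    by (simp add: Abs_fset_inverse res_space_finite)
  show ?thesis
  proof (rule bij_betw_imageI)
    show "inj_on (\<lambda>f. RFun (Abs_fset (?g f))) (?A \<rightarrow>\<^sub>E ?B)"
    proof (rule inj_onI)
      fix f h
      assume fh: "f \<in> ?A \<rightarrow>\<^sub>E ?B" "h \<in> ?A \<rightarrow>\<^sub>E ?B" "RFun (Abs_fset (?g f)) = RFun (Abs_fset (?g h))"
      then have "fset (Abs_fset (?g f)) = fset (Abs_fset (?g h))"
        by (simp only: res.inject)
      then have "?g f = ?g h"
        by (simp only: fs)
      then show "f = h"
        using fh(1,2) by (intro PiE_ext[of f ?A "\<lambda>_. ?B" h]) blast+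
    qed
    show "(\<lambda>f. RFun (Abs_fset (?g f))) ` (?A \<rightarrow>\<^sub>E ?B) = res_space (PImp \<alpha> \<beta>)"
    proof (intro equalityI subsetI)
      fix r
      assume "r \<in> (\<lambda>f. RFun (Abs_fset (?g f))) ` (?A \<rightarrow>\<^sub>E ?B)"
      then show "r \<in> res_space (PImp \<alpha> \<beta>)"
        by (auto simp: graph_fun_def fs PiE_iff image_iff)
    next
      fix r
      assume "r \<in> res_space (PImp \<alpha> \<beta>)"
      then obtain F where r: "r = RFun F" and F: "graph_fun ?A ?B F"
        by auto
      define f where "f = restrict (\<lambda>x. THE y. (x, y) \<in> fset F) ?A"
      have f: "(x, f x) \<in> fset F" if "x \<in> ?A" for x
      proof -
        have "\<exists>!y. (x, y) \<in> fset F" using F that unfolding graph_fun_def by blast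
        then show ?thesis using that theI'[of "\<lambda>y. (x, y) \<in> fset F"] by (simp add: f_def)
      qed
      have "f \<in> ?A \<rightarrow>\<^sub>E ?B"
      proof (rule PiE_I)
        show "f x \<in> ?B" if "x \<in> ?A" for x
          using f[OF that] F unfolding graph_fun_def by blast
        show "f x = undefined" if "x \<notin> ?A" for x
          using that by (simp add: f_def)
      qed
      moreover have "?g f = fset F"
      proof (intro equalityI subsetI)
        show "z \<in> fset F" if "z \<in> ?g f" for z
          using that f by blast
        show "z \<in> ?g f" if "z \<in> fset F" for z
        proof -
          obtain x y where z: "z = (x, y)" by (cases z)
          then have "x \<in> ?A" using that F unfolding graph_fun_def by blast
          then have "y = f x" using z that f F unfolding graph_fun_def by blast
          then show ?thesis using z \<open>x \<in> ?A\<close> by simp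
        qed
      qed
      ultimately show "r \<in> (\<lambda>f. RFun (Abs_fset (?g f))) ` (?A \<rightarrow>\<^sub>E ?B)"
        unfolding r by (intro image_eqI[of _ _ f]) (simp_all add: fset_inverse)
    qed
  qed
qed

end

(* Over the finitely many letters of a formula, a pointed model is determined, as far as
   satisfaction is concerned, by the set T of valuations that it realises and the valuation w of
   the actual world. The pointed model (T, w) has a characteristic formula: the state description
   of w together with the K-statement that the realised descriptions are those in T. By induction
   on the formula, each characteristic formula provably implies the formula or its negation. For K
   this is S5; for Box, persistence of PL-formulas bounds the submodels from above and the Update
   axiom realises every T' with w in T' and T' included in T; Kh is eliminated by its reduction
   axioms, which are also semantically valid. Provably one of the characteristic formulas holds, so
   a valid formula is provable. *)
theory Submission
  imports Defs
begin

section \<open>Propositional and modal reasoning in the calculus\<close>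

instance pl :: (countable) countable
  by countable_datatype

instance delkh :: (countable) countable
  by countable_datatype

text \<open>Propositional reading of DELKh: letters and formulas with outermost \<open>K\<close>,
  \<open>Kh\<close> or \<open>Box\<close> are opaque atoms whose truth value \<open>V\<close> fixes
  freely.\<close>

primrec bool_eval :: "('p delkh \<Rightarrow> bool) \<Rightarrow> 'p delkh \<Rightarrow> bool" where
  "bool_eval V (Atom p) \<longleftrightarrow> V (Atom p)"
| "bool_eval V \<^bold>\<bottom> \<longleftrightarrow> False"
| "bool_eval V (\<phi> \<^bold>\<and> \<psi>) \<longleftrightarrow> bool_eval V \<phi> \<and> bool_eval V \<psi>"
| "bool_eval V (\<phi> \<^bold>\<or> \<psi>) \<longleftrightarrow> bool_eval V \<phi> \<or> bool_eval V \<psi>"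
| "bool_eval V (\<phi> \<^bold>\<longrightarrow> \<psi>) \<longleftrightarrow> (bool_eval V \<phi> \<longrightarrow> bool_eval V \<psi>)"
| "bool_eval V (K \<phi>) \<longleftrightarrow> V (K \<phi>)"
| "bool_eval V (Kh \<alpha>) \<longleftrightarrow> V (Kh \<alpha>)"
| "bool_eval V (Box \<phi>) \<longleftrightarrow> V (Box \<phi>)"

text \<open>\<open>Taut\<close> accepts only substitution instances of formulas over
  \<open>nat\<close>, so each opaque subformula is replaced by its code as a letter. Countability
  provides the codes, and substituting \<open>from_nat\<close> restores the formula.\<close>

primrec skeleton :: "'p::countable delkh \<Rightarrow> nat pl" where
  "skeleton (Atom p) = PAtom (to_nat (Atom p))"
| "skeleton \<^bold>\<bottom> = PBot"
| "skeleton (\<phi> \<^bold>\<and> \<psi>) = PAnd (skeleton \<phi>) (skeleton \<psi>)"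
| "skeleton (\<phi> \<^bold>\<or> \<psi>) = POr (skeleton \<phi>) (skeleton \<psi>)"
| "skeleton (\<phi> \<^bold>\<longrightarrow> \<psi>) = PImp (skeleton \<phi>) (skeleton \<psi>)"
| "skeleton (K \<phi>) = PAtom (to_nat (K \<phi>))"
| "skeleton (Kh \<alpha>) = PAtom (to_nat (Kh \<alpha>))"
| "skeleton (Box \<phi>) = PAtom (to_nat (Box \<phi>))"

lemma pl_subst_skeleton: "pl_subst from_nat (skeleton \<phi>) = \<phi>"
  by (induction \<phi>) auto

lemma pl_eval_skeleton: "pl_eval v (skeleton \<phi>) \<longleftrightarrow> bool_eval (v \<circ> to_nat) \<phi>"
  by (induction \<phi>) auto

lemma bool_valid_provable:
  fixes \<phi> :: "'p::countable delkh"
  assumes "\<And>V. bool_eval V \<phi>"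
  shows "\<turnstile> \<phi>"
proof -
  have "tautology (skeleton \<phi>)"
    using assms by (simp add: tautology_def pl_eval_skeleton)
  then have "\<turnstile> pl_subst (from_nat :: nat \<Rightarrow> 'p delkh) (skeleton \<phi>)"
    by (rule Taut)
  then show ?thesis by (simp only: pl_subst_skeleton)
qed

text \<open>Premises are discharged one at a time: the implication from a premise to the goal
  follows from the remaining premises, and modus ponens removes the premise.\<close>

lemma bool_consequence:
  fixes \<phi> :: "'p::countable delkh"
  assumes "finite A" "\<And>\<psi>. \<psi> \<in> A \<Longrightarrow> \<turnstile> \<psi>" "\<And>V. \<forall>\<psi>\<in>A. bool_eval V \<psi> \<Longrightarrow> bool_eval V \<phi>"
  shows "\<turnstile> \<phi>"
  using assms
proof (induction A arbitrary: \<phi> rule: finite_induct)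
  case empty
  then show ?case by (intro bool_valid_provable) auto
next
  case (insert \<psi> A)
  have "\<turnstile> \<psi> \<^bold>\<longrightarrow> \<phi>"
    by (rule insert.IH) (use insert.prems in auto)
  then show ?case using insert.prems(1)[of \<psi>] by (auto intro: MP)
qed

lemma bool_imp:
  fixes \<phi> :: "'p::countable delkh"
  assumes "\<turnstile> \<psi>" "\<And>V. bool_eval V \<psi> \<Longrightarrow> bool_eval V \<phi>"
  shows "\<turnstile> \<phi>"
  by (rule bool_consequence[of "{\<psi>}"]) (use assms in auto)

lemma bool_imp2:
  fixes \<phi> :: "'p::countable delkh"
  assumes "\<turnstile> \<psi>" "\<turnstile> \<chi>" "\<And>V. bool_eval V \<psi> \<Longrightarrow> bool_eval V \<chi> \<Longrightarrow> bool_eval V \<phi>"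
  shows "\<turnstile> \<phi>"
  by (rule bool_consequence[of "{\<psi>, \<chi>}"]) (use assms in auto)

text \<open>Boolean reasoning under a normal modality, stated once for \<open>K\<close> and
  \<open>Box\<close>. A premise may be a theorem, brought under \<open>N\<close> by necessitation,
  or have its \<open>N\<close>-form follow from the context \<open>\<theta>\<close>.\<close>

lemma normal_consequence:
  fixes N :: "'p::countable delkh \<Rightarrow> 'p delkh"
  assumes dist: "\<And>\<phi> \<psi>. \<turnstile> N (\<phi> \<^bold>\<longrightarrow> \<psi>) \<^bold>\<longrightarrow> (N \<phi> \<^bold>\<longrightarrow> N \<psi>)"
    and nec: "\<And>\<phi>. \<turnstile> \<phi> \<Longrightarrow> \<turnstile> N \<phi>"
    and "finite A" "\<And>\<psi>. \<psi> \<in> A \<Longrightarrow> \<turnstile> \<psi> \<or> \<turnstile> \<theta> \<^bold>\<longrightarrow> N \<psi>"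
    and "\<And>V. \<forall>\<psi>\<in>A. bool_eval V \<psi> \<Longrightarrow> bool_eval V \<phi>"
  shows "\<turnstile> \<theta> \<^bold>\<longrightarrow> N \<phi>"
  using assms(3-)
proof (induction A arbitrary: \<phi> rule: finite_induct)
  case empty
  then have "\<turnstile> N \<phi>"
    by (intro nec bool_valid_provable) auto
  then show ?case by (rule bool_imp) simp
next
  case (insert \<psi> A)
  have 1: "\<turnstile> \<theta> \<^bold>\<longrightarrow> N (\<psi> \<^bold>\<longrightarrow> \<phi>)"
    by (rule insert.IH) (use insert.prems in auto)
  have "\<turnstile> \<psi> \<or> \<turnstile> \<theta> \<^bold>\<longrightarrow> N \<psi>"
    using insert.prems(1) by simp
  then have 2: "\<turnstile> \<theta> \<^bold>\<longrightarrow> N \<psi>"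
  proof
    assume "\<turnstile> \<psi>"
    from nec[OF this] show ?thesis by (rule bool_imp) simp
  qed
  from 1 have "\<turnstile> \<theta> \<^bold>\<longrightarrow> (N \<psi> \<^bold>\<longrightarrow> N \<phi>)"
    by (rule bool_imp2[OF _ dist[of \<psi> \<phi>]]) simp
  from this 2 show ?case by (rule bool_imp2) simp
qed

lemmas K_consequence = normal_consequence[of K, OF DistK NecK]
lemmas Box_consequence = normal_consequence[of Box, OF DistBox NecBox]

lemma bool_eval_Conj: "bool_eval V (Conj \<phi>s) \<longleftrightarrow> (\<forall>\<phi>\<in>set \<phi>s. bool_eval V \<phi>)"
  by (induction \<phi>s rule: Conj.induct) auto

lemma bool_eval_of_pl: "bool_eval V (of_pl \<alpha>) \<longleftrightarrow> pl_eval (\<lambda>p. V (Atom p)) \<alpha>"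
  by (induction \<alpha>) auto

section \<open>Semantics\<close>

lemma resolutions_cong: "val M w = val M' w \<Longrightarrow> resolutions M w \<alpha> = resolutions M' w \<alpha>"
  by (induction \<alpha>) auto

text \<open>Equality of the records is too strict: \<open>submodel\<close> leaves the values of
  \<open>val\<close> off the worlds open. In the \<open>Box\<close> case both models have the same
  submodels.\<close>

lemma sat_cong:
  assumes "worlds M = worlds M'" "\<forall>v\<in>worlds M. val M v = val M' v" "w \<in> worlds M"
  shows "M, w \<Turnstile> \<phi> \<longleftrightarrow> M', w \<Turnstile> \<phi>"
  using assms
proof (induction \<phi> arbitrary: w)
  case (Kh \<alpha>)
  have "resolutions M v \<alpha> = resolutions M' v \<alpha>" if "v \<in> worlds M" for v
    using Kh that by (intro resolutions_cong) auto
  then show ?case using Kh(1) by auto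
next
  case (Box \<phi>)
  have "submodel N M \<longleftrightarrow> submodel N M'" for N
    using Box.prems(1,2) by (auto simp: submodel_def subset_iff)
  then show ?case by simp
qed auto

text \<open>For an implication, a constant function serves. Nonemptiness supplies default values
  when a resolution of an implication is assembled pointwise.\<close>

lemma res_space_nonempty: "res_space \<alpha> \<noteq> {}"
proof (induction \<alpha>)
  case (PImp \<alpha> \<beta>)
  then obtain y where y: "y \<in> res_space \<beta>" by blast
  let ?F = "Abs_fset (res_space \<alpha> \<times> {y})"
  have "fset ?F = res_space \<alpha> \<times> {y}"
    by (simp add: Abs_fset_inverse res_space_finite)
  then have "graph_fun (res_space \<alpha>) (res_space \<beta>) ?F"
    using y by (auto simp: graph_fun_def)
  then show ?case by auto
qed auto

section \<open>Semantic validity of the reduction axioms for \<open>Kh\<close>\<close>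

lemma sat_Kh_PAnd: "M, w \<Turnstile> Kh (PAnd \<alpha> \<beta>) \<longleftrightarrow> M, w \<Turnstile> Kh \<alpha> \<^bold>\<and> Kh \<beta>"
proof
  assume "M, w \<Turnstile> Kh \<alpha> \<^bold>\<and> Kh \<beta>"
  then obtain x y where "x \<in> res_space \<alpha>" "\<forall>v\<in>worlds M. x \<in> resolutions M v \<alpha>"
    "y \<in> res_space \<beta>" "\<forall>v\<in>worlds M. y \<in> resolutions M v \<beta>"
    by auto
  then have "RPair x y \<in> res_space (PAnd \<alpha> \<beta>)"
    "\<forall>v\<in>worlds M. RPair x y \<in> resolutions M v (PAnd \<alpha> \<beta>)"
    by auto
  then show "M, w \<Turnstile> Kh (PAnd \<alpha> \<beta>)"
    unfolding sat.simps(7) by blast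
qed auto

text \<open>Forwards, the function sends a resolution of \<open>\<alpha>\<close> shared by the
  worlds of a submodel to one of \<open>\<beta>\<close>. Backwards, its value at \<open>x\<close> is
  a resolution of \<open>\<beta>\<close> shared by the submodel of all worlds where \<open>x\<close>
  resolves \<open>\<alpha>\<close>.\<close>

lemma sat_Kh_PImp:
  "M, w \<Turnstile> Kh (PImp \<alpha> \<beta>) \<longleftrightarrow> M, w \<Turnstile> K (Box (Kh \<alpha> \<^bold>\<longrightarrow> Kh \<beta>))"
proof
  assume "M, w \<Turnstile> Kh (PImp \<alpha> \<beta>)"
  then obtain F where F: "graph_fun (res_space \<alpha>) (res_space \<beta>) F"
    and FM: "\<And>v x y. v \<in> worlds M \<Longrightarrow> (x, y) \<in> fset F \<Longrightarrow> x \<in> resolutions M v \<alpha> \<Longrightarrow>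
      y \<in> resolutions M v \<beta>"
    by fastforce
  have "M', v \<Turnstile> Kh \<beta>" if M': "submodel M' M" and Kh: "M', v \<Turnstile> Kh \<alpha>" for M' v
  proof -
    have res: "resolutions M' u \<gamma> = resolutions M u \<gamma>" "u \<in> worlds M" if "u \<in> worlds M'" for u \<gamma>
      using M' that by (auto simp: submodel_def intro!: resolutions_cong)
    obtain x where x: "x \<in> res_space \<alpha>" "\<forall>u\<in>worlds M'. x \<in> resolutions M' u \<alpha>"
      using Kh unfolding sat.simps(7) by blast
    then obtain y where y: "(x, y) \<in> fset F" "y \<in> res_space \<beta>"
      using F unfolding graph_fun_def by blast
    have "\<forall>u\<in>worlds M'. y \<in> resolutions M' u \<beta>"
      using x y(1) res FM by metis
    then show ?thesis using y(2) by auto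
  qed
  then show "M, w \<Turnstile> K (Box (Kh \<alpha> \<^bold>\<longrightarrow> Kh \<beta>))"
    by (simp del: sat.simps(7))
next
  assume *: "M, w \<Turnstile> K (Box (Kh \<alpha> \<^bold>\<longrightarrow> Kh \<beta>))"
  have "\<exists>y\<in>res_space \<beta>. \<forall>v\<in>worlds M. x \<in> resolutions M v \<alpha> \<longrightarrow> y \<in> resolutions M v \<beta>"
    if x: "x \<in> res_space \<alpha>" for x
  proof -
    define X where "X = {v \<in> worlds M. x \<in> resolutions M v \<alpha>}"
    show ?thesis
    proof (cases "X = {}")
      case True
      \<comment> \<open>No world constrains the value at \<open>x\<close>, and an empty set of
        worlds is not a submodel, so an arbitrary element is taken.\<close>
      then show ?thesis using res_space_nonempty[of \<beta>] unfolding X_def by blast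
    next
      case False
      then obtain v where v: "v \<in> X" by blast
      let ?M = "\<lparr>worlds = X, val = val M\<rparr>"
      have res: "resolutions ?M u \<gamma> = resolutions M u \<gamma>" for u \<gamma>
        by (rule resolutions_cong) simp
      have "submodel ?M M"
        using v by (auto simp: submodel_def X_def)
      moreover have "\<forall>u\<in>X. x \<in> resolutions M u \<alpha>"
        by (simp add: X_def)
      then have "?M, v \<Turnstile> Kh \<alpha>"
        using x by (auto simp: res)
      ultimately have "?M, v \<Turnstile> Kh \<beta>"
        using * v by (auto simp: X_def simp del: sat.simps(7))
      then obtain y where "y \<in> res_space \<beta>" "\<forall>u\<in>X. y \<in> resolutions M u \<beta>"
        by (auto simp: res)
      then show ?thesis by (auto simp: X_def)
    qed
  qed
  then obtain f where f: "\<And>x. x \<in> res_space \<alpha> \<Longrightarrow> f x \<in> res_space \<beta>"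
    "\<And>x v. x \<in> res_space \<alpha> \<Longrightarrow> v \<in> worlds M \<Longrightarrow> x \<in> resolutions M v \<alpha> \<Longrightarrow> f x \<in> resolutions M v \<beta>"
    by metis
  let ?F = "Abs_fset ((\<lambda>x. (x, f x)) ` res_space \<alpha>)"
  have F: "fset ?F = (\<lambda>x. (x, f x)) ` res_space \<alpha>"
    by (simp add: Abs_fset_inverse res_space_finite)
  have g: "graph_fun (res_space \<alpha>) (res_space \<beta>) ?F"
    using f(1) by (auto simp: graph_fun_def F)
  then have "RFun ?F \<in> res_space (PImp \<alpha> \<beta>)" by simp
  moreover have "RFun ?F \<in> resolutions M v (PImp \<alpha> \<beta>)" if "v \<in> worlds M" for v
    using that g f(2) by (auto simp: F)
  ultimately show "M, w \<Turnstile> Kh (PImp \<alpha> \<beta>)"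
    unfolding sat.simps(7) by blast
qed

section \<open>Characteristic formulas\<close>

text \<open>Conjunctions and disjunctions are built inside PL because \<open>PersPL\<close> and
  \<open>Update\<close> speak of PL-formulas.\<close>

definition PConj :: "'p pl list \<Rightarrow> 'p pl" where
  "PConj \<alpha>s = foldr PAnd \<alpha>s (PImp PBot PBot)"

definition PDisj :: "'p pl list \<Rightarrow> 'p pl" where
  "PDisj \<alpha>s = foldr POr \<alpha>s PBot"

lemma pl_eval_PConj: "pl_eval v (PConj \<alpha>s) \<longleftrightarrow> (\<forall>\<alpha>\<in>set \<alpha>s. pl_eval v \<alpha>)"
  by (induction \<alpha>s) (auto simp: PConj_def)

lemma pl_eval_PDisj: "pl_eval v (PDisj \<alpha>s) \<longleftrightarrow> (\<exists>\<alpha>\<in>set \<alpha>s. pl_eval v \<alpha>)"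
  by (induction \<alpha>s) (auto simp: PDisj_def)

text \<open>Some listing of a finite set; its order is immaterial, since the Boolean lemmas depend
  only on the set of entries.\<close>

definition enum :: "'a set \<Rightarrow> 'a list" where
  "enum A = (SOME xs. set xs = A)"

lemma set_enum: "finite A \<Longrightarrow> set (enum A) = A"
  unfolding enum_def by (rule someI_ex) (rule finite_list)

text \<open>The worlds in \<open>W\<close> name the valuations of the finitely many letters in
  \<open>P\<close>, each exactly once, so a subset of \<open>W\<close> is a set of realised
  valuations.\<close>

locale valuation_worlds =
  fixes P :: "'p::countable set" and W :: "'w set" and v :: "'w \<Rightarrow> 'p set"
  assumes finite_P: "finite P" and bij_v: "bij_betw v W (Pow P)"
begin

lemma finite_W: "finite W"
  using bij_betw_finite[OF bij_v] finite_P by simp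

lemma set_enum_W: "T \<subseteq> W \<Longrightarrow> set (enum T) = T"
  using finite_W by (intro set_enum) (rule finite_subset)

definition desc :: "'w \<Rightarrow> 'p pl" where
  "desc w = PConj (map (\<lambda>p. if p \<in> v w then PAtom p else PImp (PAtom p) PBot) (enum P))"

definition some_desc :: "'w set \<Rightarrow> 'p pl" where
  "some_desc T = PDisj (map desc (enum T))"

text \<open>Literally the formula under \<open>Dia\<close> in \<open>Update\<close> for
  \<open>some_desc T\<close> and the descriptions of \<open>T\<close>, so that the axiom applies
  without rewriting.\<close>

definition realised :: "'w set \<Rightarrow> 'p delkh" where
  "realised T = K (of_pl (some_desc T)) \<^bold>\<and> Conj (map (\<lambda>\<beta>. Khat (of_pl \<beta>)) (map desc (enum T)))"

definition char_fm :: "'w set \<Rightarrow> 'w \<Rightarrow> 'p delkh" where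
  "char_fm T w = of_pl (desc w) \<^bold>\<and> realised T"

definition desc_model :: "'w set \<Rightarrow> ('w, 'p) model" where
  "desc_model T = \<lparr>worlds = T, val = v\<rparr>"

text \<open>The invariant of the induction on formulas: a truth lemma that ties the provable verdict
  to the semantic one.\<close>

definition decided :: "'p delkh \<Rightarrow> bool" where
  "decided \<phi> \<longleftrightarrow> (\<forall>T w. T \<subseteq> W \<longrightarrow> w \<in> T \<longrightarrow>
     \<turnstile> char_fm T w \<^bold>\<longrightarrow> (if desc_model T, w \<Turnstile> \<phi> then \<phi> else Neg \<phi>))"

lemma pl_eval_desc: "pl_eval u (desc w) \<longleftrightarrow> (\<forall>p\<in>P. p \<in> v w \<longleftrightarrow> u p)"
  by (auto simp: desc_def pl_eval_PConj set_enum finite_P simp del: if_image_distrib split: if_splits)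

lemma pl_eval_some_desc:
  "T \<subseteq> W \<Longrightarrow> pl_eval u (some_desc T) \<longleftrightarrow> (\<exists>w\<in>T. pl_eval u (desc w))"
  by (simp add: some_desc_def pl_eval_PDisj set_enum_W)

text \<open>Since \<open>v\<close> is onto \<open>Pow P\<close>, every valuation restricted to
  \<open>P\<close> is the valuation of some world.\<close>

lemma pl_eval_some_desc_W: "pl_eval u (some_desc W)"
proof -
  have "{p \<in> P. u p} \<in> v ` W"
    using bij_v by (auto simp: bij_betw_def)
  then obtain w where "w \<in> W" "{p \<in> P. u p} = v w" by blast
  then show ?thesis by (auto simp: pl_eval_some_desc pl_eval_desc intro!: bexI[of _ w])
qed

lemma bool_eval_some_desc:
  "T \<subseteq> W \<Longrightarrow> bool_eval V (of_pl (some_desc T)) \<longleftrightarrow> (\<exists>w\<in>T. bool_eval V (of_pl (desc w)))"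
  by (simp add: bool_eval_of_pl pl_eval_some_desc)

lemma bool_eval_realised:
  "T \<subseteq> W \<Longrightarrow> bool_eval V (realised T) \<longleftrightarrow>
     V (K (of_pl (some_desc T))) \<and> (\<forall>w\<in>T. \<not> V (K (Neg (of_pl (desc w)))))"
  by (simp add: realised_def bool_eval_Conj set_enum_W)

lemma bool_eval_char_fm:
  "bool_eval V (char_fm T w) \<longleftrightarrow> bool_eval V (of_pl (desc w)) \<and> bool_eval V (realised T)"
  by (simp add: char_fm_def)

text \<open>Positive and negative introspection: \<open>FourK\<close> handles the \<open>K\<close>
  conjunct and \<open>FiveK\<close> each \<open>Khat\<close> conjunct.\<close>

lemma realised_imp_K_realised:
  assumes T: "T \<subseteq> W"
  shows "\<turnstile> realised T \<^bold>\<longrightarrow> K (realised T)"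
proof (rule K_consequence)
  let ?A = "insert (K (of_pl (some_desc T))) ((\<lambda>w. Khat (of_pl (desc w))) ` T)"
  show "finite ?A"
    using T finite_W finite_subset by auto
  show "\<turnstile> \<psi> \<or> \<turnstile> realised T \<^bold>\<longrightarrow> K \<psi>" if \<psi>: "\<psi> \<in> ?A" for \<psi>
  proof (cases "\<psi> = K (of_pl (some_desc T))")
    case True
    show ?thesis unfolding True
      by (rule disjI2, rule bool_imp[OF FourK]) (use T in \<open>auto simp: bool_eval_realised\<close>)
  next
    case False
    then obtain w where w: "w \<in> T" "\<psi> = Khat (of_pl (desc w))"
      using \<psi> by auto
    show ?thesis unfolding w(2)
      by (rule disjI2, rule bool_imp[OF FiveK[of "Neg (of_pl (desc w))"]])
        (use T w in \<open>auto simp: bool_eval_realised\<close>)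
  qed
  show "bool_eval V (realised T)" if "\<forall>\<psi>\<in>?A. bool_eval V \<psi>" for V
    using that T by (auto simp: bool_eval_realised)
qed

text \<open>If the actual description is that of \<open>w\<close> and only descriptions from
  \<open>T\<close> are possible, then the set of those that are possible is some subset of
  \<open>T\<close> containing \<open>w\<close>. It thus suffices to treat each candidate
  subset.\<close>

lemma provable_from_char_fms:
  assumes T: "T \<subseteq> W" "w \<in> T"
    and sub: "\<And>T'. T' \<subseteq> T \<Longrightarrow> w \<in> T' \<Longrightarrow> \<turnstile> char_fm T' w \<^bold>\<longrightarrow> \<phi>"
  shows "\<turnstile> of_pl (desc w) \<^bold>\<and> K (of_pl (some_desc T)) \<^bold>\<longrightarrow> \<phi>"
proof -
  \<comment> \<open>Excluding every description in \<open>T - T'\<close> leaves only those in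
    \<open>T'\<close>.\<close>
  define shrink where "shrink T' = Conj (K (of_pl (some_desc T)) #
      map (\<lambda>u. K (Neg (of_pl (desc u)))) (enum (T - T'))) \<^bold>\<longrightarrow> K (of_pl (some_desc T'))" for T'
  have enum: "set (enum (T - T')) = T - T'" for T'
    using T(1) by (intro set_enum_W) auto
  have shrink: "\<turnstile> shrink T'" if "T' \<subseteq> T" for T'
    unfolding shrink_def
  proof (rule K_consequence)
    let ?\<theta> = "Conj (K (of_pl (some_desc T)) # map (\<lambda>u. K (Neg (of_pl (desc u)))) (enum (T - T')))"
    let ?A = "insert (of_pl (some_desc T)) ((\<lambda>u. Neg (of_pl (desc u))) ` (T - T'))"
    show "finite ?A"
      using finite_subset[OF T(1) finite_W] by simp
    show "\<turnstile> \<psi> \<or> \<turnstile> ?\<theta> \<^bold>\<longrightarrow> K \<psi>" if "\<psi> \<in> ?A" for \<psi>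
      using that by (intro disjI2 bool_valid_provable) (auto simp: bool_eval_Conj enum)
    show "bool_eval V (of_pl (some_desc T'))" if "\<forall>\<psi>\<in>?A. bool_eval V \<psi>" for V
      using that T \<open>T' \<subseteq> T\<close> by (auto simp: bool_eval_some_desc)
  qed
  let ?S = "{T'. T' \<subseteq> T \<and> w \<in> T'}"
  \<comment> \<open>The first premise, an instance of \<open>TK\<close>, makes the actual
    description count as possible; it forces \<open>w\<close> into the set read off from
    \<open>V\<close> below.\<close>
  let ?A = "insert (K (Neg (of_pl (desc w))) \<^bold>\<longrightarrow> Neg (of_pl (desc w)))
    (shrink ` ?S \<union> (\<lambda>T'. char_fm T' w \<^bold>\<longrightarrow> \<phi>) ` ?S)"
  show ?thesis
  proof (rule bool_consequence)
    have "finite (Pow T)"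
      using T(1) finite_W finite_subset by auto
    then show "finite ?A"
      using finite_subset[of ?S "Pow T"] by auto
    show "\<turnstile> \<psi>" if "\<psi> \<in> ?A" for \<psi>
      using that sub shrink TK by auto
    show "bool_eval V (of_pl (desc w) \<^bold>\<and> K (of_pl (some_desc T)) \<^bold>\<longrightarrow> \<phi>)"
      if A: "\<forall>\<psi>\<in>?A. bool_eval V \<psi>" for V
    proof -
      have "bool_eval V \<phi>" if w: "bool_eval V (of_pl (desc w))" and K: "V (K (of_pl (some_desc T)))"
      proof -
        \<comment> \<open>The descriptions that \<open>V\<close> treats as possible; this picks the
          case to use.\<close>
        define T' where "T' = {u \<in> T. \<not> V (K (Neg (of_pl (desc u))))}"
        have T': "T' \<in> ?S"
          using A w T by (auto simp: T'_def)
        then have "bool_eval V (shrink T')" "bool_eval V (char_fm T' w \<^bold>\<longrightarrow> \<phi>)"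
          using A by blast+
        moreover have "T' \<subseteq> W"
          using T(1) T' by blast
        then have "bool_eval V (char_fm T' w)" if "V (K (of_pl (some_desc T')))"
          using that w by (simp add: bool_eval_char_fm bool_eval_realised) (simp add: T'_def)
        ultimately show ?thesis
          using K by (auto simp: shrink_def bool_eval_Conj enum T'_def)
      qed
      then show ?thesis by simp
    qed
  qed
qed

section \<open>Characteristic formulas decide all formulas\<close>

lemma decided_pos:
  "decided \<phi> \<Longrightarrow> T \<subseteq> W \<Longrightarrow> w \<in> T \<Longrightarrow> desc_model T, w \<Turnstile> \<phi> \<Longrightarrow> \<turnstile> char_fm T w \<^bold>\<longrightarrow> \<phi>"
  using decided_def[THEN iffD1, rule_format, of \<phi> T w] by simp

lemma decided_neg:
  "decided \<phi> \<Longrightarrow> T \<subseteq> W \<Longrightarrow> w \<in> T \<Longrightarrow> \<not> desc_model T, w \<Turnstile> \<phi> \<Longrightarrow> \<turnstile> char_fm T w \<^bold>\<longrightarrow> Neg \<phi>"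
  using decided_def[THEN iffD1, rule_format, of \<phi> T w] by simp

lemma decidedI:
  assumes "\<And>T w. T \<subseteq> W \<Longrightarrow> w \<in> T \<Longrightarrow> desc_model T, w \<Turnstile> \<phi> \<Longrightarrow> \<turnstile> char_fm T w \<^bold>\<longrightarrow> \<phi>"
    and "\<And>T w. T \<subseteq> W \<Longrightarrow> w \<in> T \<Longrightarrow> \<not> desc_model T, w \<Turnstile> \<phi> \<Longrightarrow> \<turnstile> char_fm T w \<^bold>\<longrightarrow> Neg \<phi>"
  shows "decided \<phi>"
  using assms by (auto simp: decided_def)

lemma decided_Atom: "p \<in> P \<Longrightarrow> decided (Atom p)"
  by (rule decidedI; rule bool_valid_provable)
    (auto simp: bool_eval_char_fm bool_eval_of_pl pl_eval_desc desc_model_def)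

lemma decided_Bot: "decided \<^bold>\<bottom>"
  by (rule decidedI) (auto intro: bool_valid_provable)

text \<open>Satisfaction and \<open>bool_eval\<close> interpret the connective by the same truth
  function \<open>f\<close>, so the verdicts on the components combine.\<close>

lemma decided_bool2:
  assumes "decided \<phi>" "decided \<psi>"
    and sat: "\<And>T w. desc_model T, w \<Turnstile> \<chi> \<longleftrightarrow> f (desc_model T, w \<Turnstile> \<phi>) (desc_model T, w \<Turnstile> \<psi>)"
    and eval: "\<And>V. bool_eval V \<chi> \<longleftrightarrow> f (bool_eval V \<phi>) (bool_eval V \<psi>)"
  shows "decided \<chi>"
  unfolding decided_def
proof (intro allI impI)
  fix T w assume "T \<subseteq> W" "w \<in> T"
  then have "\<turnstile> char_fm T w \<^bold>\<longrightarrow> (if desc_model T, w \<Turnstile> \<phi> then \<phi> else Neg \<phi>)"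
    "\<turnstile> char_fm T w \<^bold>\<longrightarrow> (if desc_model T, w \<Turnstile> \<psi> then \<psi> else Neg \<psi>)"
    using assms(1,2) by (auto simp: decided_def)
  then show "\<turnstile> char_fm T w \<^bold>\<longrightarrow> (if desc_model T, w \<Turnstile> \<chi> then \<chi> else Neg \<chi>)"
    by (rule bool_imp2) (auto simp: sat eval split: if_splits)
qed

lemma decided_Imp: "decided \<phi> \<Longrightarrow> decided \<psi> \<Longrightarrow> decided (\<phi> \<^bold>\<longrightarrow> \<psi>)"
  by (rule decided_bool2[of \<phi> \<psi> _ "(\<longrightarrow>)"]) auto

lemma decided_And: "decided \<phi> \<Longrightarrow> decided \<psi> \<Longrightarrow> decided (\<phi> \<^bold>\<and> \<psi>)"
  by (rule decided_bool2[of \<phi> \<psi> _ "(\<and>)"]) auto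

lemma decided_Or: "decided \<phi> \<Longrightarrow> decided \<psi> \<Longrightarrow> decided (\<phi> \<^bold>\<or> \<psi>)"
  by (rule decided_bool2[of \<phi> \<psi> _ "(\<or>)"]) auto

text \<open>Transfers decidedness along the reduction axioms for \<open>Kh\<close>, each of which is
  both provable and semantically valid.\<close>

lemma decided_equiv:
  assumes "decided \<phi>" "\<turnstile> \<psi> \<^bold>\<longleftrightarrow> \<phi>"
    and "\<And>T w. w \<in> T \<Longrightarrow> desc_model T, w \<Turnstile> \<psi> \<longleftrightarrow> desc_model T, w \<Turnstile> \<phi>"
  shows "decided \<psi>"
proof (rule decidedI)
  fix T w assume T: "T \<subseteq> W" "w \<in> T"
  show "\<turnstile> char_fm T w \<^bold>\<longrightarrow> \<psi>" if "desc_model T, w \<Turnstile> \<psi>"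
    by (rule bool_imp2[OF decided_pos[OF assms(1) T] assms(2)]) (use that assms(3) T in auto)
  show "\<turnstile> char_fm T w \<^bold>\<longrightarrow> Neg \<psi>" if "\<not> desc_model T, w \<Turnstile> \<psi>"
    by (rule bool_imp2[OF decided_neg[OF assms(1) T] assms(2)]) (use that assms(3) T in auto)
qed

text \<open>\<open>realised T\<close> is itself known. If \<open>\<phi>\<close> holds throughout
  \<open>T\<close>, each description in \<open>T\<close> yields it under \<open>K\<close>. If
  \<open>\<phi>\<close> fails at \<open>u\<close>, then \<open>K \<phi>\<close> would exclude the
  description of \<open>u\<close>, which \<open>realised T\<close> declares possible.\<close>

lemma decided_K:
  assumes \<phi>: "decided \<phi>"
  shows "decided (K \<phi>)"
proof (rule decidedI)
  fix T w assume T: "T \<subseteq> W" "w \<in> T"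
  note K_realised = realised_imp_K_realised[OF T(1)]
  show "\<turnstile> char_fm T w \<^bold>\<longrightarrow> K \<phi>" if sat: "desc_model T, w \<Turnstile> K \<phi>"
  proof -
    have "\<turnstile> realised T \<^bold>\<longrightarrow> K \<phi>"
    proof (rule K_consequence)
      let ?A = "{realised T, of_pl (some_desc T)} \<union> (\<lambda>u. char_fm T u \<^bold>\<longrightarrow> \<phi>) ` T"
      show "finite ?A"
        using T finite_W finite_subset by auto
      have "\<turnstile> char_fm T u \<^bold>\<longrightarrow> \<phi>" if "u \<in> T" for u
        using sat that by (intro decided_pos[OF \<phi> T(1)]) (auto simp: desc_model_def)
      moreover have "\<turnstile> realised T \<^bold>\<longrightarrow> K (of_pl (some_desc T))"
        using T by (intro bool_valid_provable) (simp add: bool_eval_realised)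
      ultimately show "\<turnstile> \<psi> \<or> \<turnstile> realised T \<^bold>\<longrightarrow> K \<psi>" if "\<psi> \<in> ?A" for \<psi>
        using that K_realised by auto
      show "bool_eval V \<phi>" if "\<forall>\<psi>\<in>?A. bool_eval V \<psi>" for V
        using that T by (auto simp: bool_eval_some_desc bool_eval_char_fm)
    qed
    then show ?thesis
      by (rule bool_imp) (simp add: bool_eval_char_fm)
  qed
  show "\<turnstile> char_fm T w \<^bold>\<longrightarrow> Neg (K \<phi>)" if nsat: "\<not> desc_model T, w \<Turnstile> K \<phi>"
  proof -
    obtain u where u: "u \<in> T" "\<not> desc_model T, u \<Turnstile> \<phi>"
      using nsat by (auto simp: desc_model_def)
    have "\<turnstile> (realised T \<^bold>\<and> K \<phi>) \<^bold>\<longrightarrow> K (Neg (of_pl (desc u)))"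
    proof (rule K_consequence)
      let ?A = "{realised T, \<phi>, char_fm T u \<^bold>\<longrightarrow> Neg \<phi>}"
      show "finite ?A" by simp
      have "\<turnstile> (realised T \<^bold>\<and> K \<phi>) \<^bold>\<longrightarrow> K (realised T)"
        by (rule bool_imp[OF K_realised]) simp
      moreover have "\<turnstile> (realised T \<^bold>\<and> K \<phi>) \<^bold>\<longrightarrow> K \<phi>"
        by (rule bool_valid_provable) simp
      ultimately show "\<turnstile> \<psi> \<or> \<turnstile> (realised T \<^bold>\<and> K \<phi>) \<^bold>\<longrightarrow> K \<psi>" if "\<psi> \<in> ?A" for \<psi>
        using that decided_neg[OF \<phi> T(1) u] by auto
      show "bool_eval V (Neg (of_pl (desc u)))" if "\<forall>\<psi>\<in>?A. bool_eval V \<psi>" for V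
        using that by (auto simp: bool_eval_char_fm)
    qed
    then show ?thesis
      by (rule bool_imp) (use T u in \<open>auto simp: bool_eval_char_fm bool_eval_realised\<close>)
  qed
qed

text \<open>Up to values off the worlds, the submodels of \<open>desc_model T\<close> are the models
  \<open>desc_model T'\<close> for nonempty subsets \<open>T'\<close>.\<close>

lemma sat_Box_desc_model:
  assumes "w \<in> T"
  shows "desc_model T, w \<Turnstile> Box \<phi> \<longleftrightarrow> (\<forall>T'. T' \<subseteq> T \<and> w \<in> T' \<longrightarrow> desc_model T', w \<Turnstile> \<phi>)"
proof (intro iffI allI impI)
  fix T' assume "desc_model T, w \<Turnstile> Box \<phi>" "T' \<subseteq> T \<and> w \<in> T'"
  moreover from this(2) have "submodel (desc_model T') (desc_model T)"
    by (auto simp: submodel_def desc_model_def)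
  ultimately show "desc_model T', w \<Turnstile> \<phi>"
    by (simp add: desc_model_def)
next
  assume *: "\<forall>T'. T' \<subseteq> T \<and> w \<in> T' \<longrightarrow> desc_model T', w \<Turnstile> \<phi>"
  have "M', w \<Turnstile> \<phi>" if "submodel M' (desc_model T)" "w \<in> worlds M'" for M'
  proof -
    have "M', w \<Turnstile> \<phi> \<longleftrightarrow> desc_model (worlds M'), w \<Turnstile> \<phi>"
      using that by (intro sat_cong) (auto simp: submodel_def desc_model_def)
    then show ?thesis
      using * that by (auto simp: submodel_def desc_model_def)
  qed
  then show "desc_model T, w \<Turnstile> Box \<phi>" by simp
qed

text \<open>Positively, \<open>PersPL\<close> and \<open>KBox\<close> carry the actual description
  and the bound \<open>T\<close> under \<open>Box\<close>, where the cases over subsets apply.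
  Negatively, \<open>Update\<close> reaches a subset \<open>T'\<close> at which
  \<open>\<phi>\<close> fails.\<close>

lemma decided_Box:
  assumes \<phi>: "decided \<phi>"
  shows "decided (Box \<phi>)"
proof (rule decidedI)
  fix T w assume T: "T \<subseteq> W" "w \<in> T"
  show "\<turnstile> char_fm T w \<^bold>\<longrightarrow> Box \<phi>" if sat: "desc_model T, w \<Turnstile> Box \<phi>"
  proof (rule Box_consequence)
    let ?D = "of_pl (some_desc T)"
    let ?A = "{of_pl (desc w), K ?D, of_pl (desc w) \<^bold>\<and> K ?D \<^bold>\<longrightarrow> \<phi>}"
    show "finite ?A" by simp
    have "\<turnstile> char_fm T' w \<^bold>\<longrightarrow> \<phi>" if "T' \<subseteq> T" "w \<in> T'" for T'
      using that T sat sat_Box_desc_model[of w T \<phi>] by (intro decided_pos[OF \<phi>]) auto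
    then have "\<turnstile> of_pl (desc w) \<^bold>\<and> K ?D \<^bold>\<longrightarrow> \<phi>"
      by (rule provable_from_char_fms[OF T])
    moreover have "\<turnstile> char_fm T w \<^bold>\<longrightarrow> Box (of_pl (desc w))"
      by (rule bool_imp[OF PersPL[of "desc w"]]) (simp add: bool_eval_char_fm)
    moreover have "\<turnstile> char_fm T w \<^bold>\<longrightarrow> Box (K ?D)"
    proof -
      have "\<turnstile> K ?D \<^bold>\<longrightarrow> K (Box ?D)"
        by (rule MP[OF DistK NecK[OF PersPL]])
      then show ?thesis
        by (rule bool_imp2[OF _ KBox]) (use T in \<open>auto simp: bool_eval_char_fm bool_eval_realised\<close>)
    qed
    ultimately show "\<turnstile> \<psi> \<or> \<turnstile> char_fm T w \<^bold>\<longrightarrow> Box \<psi>" if "\<psi> \<in> ?A" for \<psi>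
      using that by auto
  qed auto
  show "\<turnstile> char_fm T w \<^bold>\<longrightarrow> Neg (Box \<phi>)" if nsat: "\<not> desc_model T, w \<Turnstile> Box \<phi>"
  proof -
    obtain T' where T': "T' \<subseteq> T" "w \<in> T'" "\<not> desc_model T', w \<Turnstile> \<phi>"
      using nsat T sat_Box_desc_model[of w T \<phi>] by blast
    let ?a = "some_desc T'"
    have T'W: "T' \<subseteq> W" using T' T by blast
    \<comment> \<open>Reaching \<open>T'\<close> would make its characteristic formula true, as the
      description of \<open>w\<close> persists, and thereby refute \<open>\<phi>\<close>.\<close>
    have "\<turnstile> (of_pl (desc w) \<^bold>\<and> Box \<phi>) \<^bold>\<longrightarrow> Box (Neg (realised T'))"
    proof (rule Box_consequence)
      let ?A = "{of_pl (desc w), \<phi>, char_fm T' w \<^bold>\<longrightarrow> Neg \<phi>}"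
      show "finite ?A" by simp
      have "\<turnstile> (of_pl (desc w) \<^bold>\<and> Box \<phi>) \<^bold>\<longrightarrow> Box (of_pl (desc w))"
        by (rule bool_imp[OF PersPL[of "desc w"]]) simp
      moreover have "\<turnstile> (of_pl (desc w) \<^bold>\<and> Box \<phi>) \<^bold>\<longrightarrow> Box \<phi>"
        by (rule bool_valid_provable) simp
      ultimately show "\<turnstile> \<psi> \<or> \<turnstile> (of_pl (desc w) \<^bold>\<and> Box \<phi>) \<^bold>\<longrightarrow> Box \<psi>" if "\<psi> \<in> ?A" for \<psi>
        using that decided_neg[OF \<phi> T'W T'(2,3)] by auto
      show "bool_eval V (Neg (realised T'))" if "\<forall>\<psi>\<in>?A. bool_eval V \<psi>" for V
        using that by (auto simp: bool_eval_char_fm)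
    qed
    moreover have "\<turnstile> char_fm T w \<^bold>\<longrightarrow> Dia (realised T')"
    proof -
      \<comment> \<open>Contraposed, this turns the possibility of a description in
        \<open>T'\<close>, given by \<open>realised T\<close>, into the possibility required by the
        hypothesis of \<open>Update\<close>.\<close>
      define narrow where "narrow u = K (Neg (of_pl ?a \<^bold>\<and> of_pl (desc u))) \<^bold>\<longrightarrow>
        K (Neg (of_pl (desc u)))" for u
      let ?U = "of_pl ?a \<^bold>\<and> Conj (map (\<lambda>\<beta>. Khat (of_pl ?a \<^bold>\<and> of_pl \<beta>)) (map desc (enum T')))
        \<^bold>\<longrightarrow> Dia (realised T')"
      have narrow: "\<turnstile> narrow u" if "u \<in> T'" for u
        unfolding narrow_def
      proof (rule K_consequence[where A = "{Neg (of_pl ?a \<^bold>\<and> of_pl (desc u))}"])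
        show "\<turnstile> \<psi> \<or> \<turnstile> K (Neg (of_pl ?a \<^bold>\<and> of_pl (desc u))) \<^bold>\<longrightarrow> K \<psi>"
          if "\<psi> \<in> {Neg (of_pl ?a \<^bold>\<and> of_pl (desc u))}" for \<psi>
          using that by (intro disjI2 bool_valid_provable) simp
      qed (use \<open>u \<in> T'\<close> T'W in \<open>auto simp: bool_eval_some_desc\<close>)
      show ?thesis
      proof (rule bool_consequence)
        let ?A = "insert ?U (narrow ` T')"
        show "finite ?A"
          using T'W finite_W finite_subset by auto
        have "\<turnstile> ?U" unfolding realised_def by (rule Update)
        then show "\<turnstile> \<psi>" if "\<psi> \<in> ?A" for \<psi>
          using that narrow by auto
        show "bool_eval V (char_fm T w \<^bold>\<longrightarrow> Dia (realised T'))" if "\<forall>\<psi>\<in>?A. bool_eval V \<psi>" for V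
          using that T T' T'W
          by (auto simp: bool_eval_char_fm bool_eval_realised bool_eval_Conj set_enum_W
              bool_eval_some_desc narrow_def)
      qed
    qed
    ultimately show ?thesis
      by (rule bool_imp2) (auto simp: bool_eval_char_fm)
  qed
qed

text \<open>Each \<open>Kh\<close> formula reduces to \<open>Kh\<close> of smaller formulas; letters
  reduce to \<open>K\<close>. The implication case introduces \<open>Box\<close>, so
  \<open>decided_Box\<close> has to come first.\<close>

lemma decided_Kh: "set_pl \<alpha> \<subseteq> P \<Longrightarrow> decided (Kh \<alpha>)"
proof (induction \<alpha>)
  case (PAtom p)
  then have "decided (K (Atom p))"
    by (intro decided_K decided_Atom) simp
  moreover have "\<turnstile> Kh (PAtom p) \<^bold>\<longleftrightarrow> K (Atom p)"
    by (rule bool_imp2[OF KhAtom[of p] KhK[of "PAtom p"]]) simp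
  ultimately show ?case by (rule decided_equiv) auto
next
  case PBot
  \<comment> \<open>Here it matters that \<open>T\<close> contains \<open>w\<close>: over no worlds
    at all, \<open>Kh PBot\<close> would hold vacuously.\<close>
  show ?case by (rule decided_equiv[OF decided_Bot KhBot]) (auto simp: desc_model_def)
next
  case (PAnd \<alpha> \<beta>)
  then have "decided (Kh \<alpha> \<^bold>\<and> Kh \<beta>)" by (intro decided_And) auto
  then show ?case by (rule decided_equiv[OF _ KhAnd sat_Kh_PAnd])
next
  case (POr \<alpha> \<beta>)
  then have "decided (Kh \<alpha> \<^bold>\<or> Kh \<beta>)" by (intro decided_Or) auto
  then show ?case by (rule decided_equiv[OF _ KhOr]) (auto simp: desc_model_def)
next
  case (PImp \<alpha> \<beta>)
  then have "decided (K (Box (Kh \<alpha> \<^bold>\<longrightarrow> Kh \<beta>)))"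
    by (intro decided_K decided_Box decided_Imp) auto
  then show ?case by (rule decided_equiv[OF _ KhImp sat_Kh_PImp])
qed

section \<open>From decidedness to completeness\<close>

lemma decided_all: "set_delkh \<phi> \<subseteq> P \<Longrightarrow> decided \<phi>"
  by (induction \<phi>)
    (auto intro: decided_Atom decided_Bot decided_And decided_Or decided_Imp decided_K decided_Kh
      decided_Box)

text \<open>The disjunction of all descriptions is a tautology, hence known. Some description in
  \<open>W\<close> is therefore actual, and the cases over subsets of \<open>W\<close> finish the
  proof.\<close>

lemma completeness:
  assumes "set_delkh \<phi> \<subseteq> P"
    and valid: "\<And>T w. T \<subseteq> W \<Longrightarrow> w \<in> T \<Longrightarrow> desc_model T, w \<Turnstile> \<phi>"
  shows "\<turnstile> \<phi>"
proof (rule bool_consequence)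
  let ?D = "of_pl (some_desc W)"
  let ?A = "insert (K ?D) ((\<lambda>w. of_pl (desc w) \<^bold>\<and> K ?D \<^bold>\<longrightarrow> \<phi>) ` W)"
  have D: "bool_eval V ?D" for V
    by (simp add: bool_eval_of_pl pl_eval_some_desc_W)
  show "finite ?A" using finite_W by simp
  have "\<turnstile> K ?D"
    by (intro NecK bool_valid_provable D)
  moreover have "\<turnstile> of_pl (desc w) \<^bold>\<and> K ?D \<^bold>\<longrightarrow> \<phi>" if "w \<in> W" for w
    using that valid by (intro provable_from_char_fms decided_pos decided_all assms(1)) auto
  ultimately show "\<turnstile> \<psi>" if "\<psi> \<in> ?A" for \<psi>
    using that by auto
  show "bool_eval V \<phi>" if "\<forall>\<psi>\<in>?A. bool_eval V \<psi>" for V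
    using that D[of V] by (auto simp: bool_eval_some_desc)
qed

end

lemma finite_set_pl: "finite (set_pl \<alpha>)"
  by (induction \<alpha>) auto

lemma finite_set_delkh: "finite (set_delkh \<phi>)"
  by (induction \<phi>) (auto simp: finite_set_pl)

theorem theorem43:
  fixes \<phi> :: "('p :: countable) delkh"
  assumes "infinite (UNIV :: 'w set)"
    and "\<forall>(M :: ('w, 'p) model) w. epistemic_model M \<and> w \<in> worlds M \<longrightarrow> M, w \<Turnstile> \<phi>"
  shows "\<turnstile> \<phi>"
proof -
  let ?P = "set_delkh \<phi>"
  \<comment> \<open>Infinity of the type of worlds enters only here: it provides one world for each
    valuation of the letters of \<open>\<phi>\<close>.\<close>
  obtain W :: "'w set" where W: "finite W" "card W = card (Pow ?P)"
    using infinite_arbitrarily_large[OF assms(1)] by blast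
  then obtain v where "bij_betw v W (Pow ?P)"
    using finite_same_card_bij[of W "Pow ?P"] finite_set_delkh by auto
  then interpret valuation_worlds ?P W v
    by unfold_locales (rule finite_set_delkh)
  show ?thesis
  proof (rule completeness)
    fix T :: "'w set" and w assume "w \<in> T"
    then have "epistemic_model (desc_model T)" "w \<in> worlds (desc_model T)"
      by (auto simp: epistemic_model_def desc_model_def)
    then show "desc_model T, w \<Turnstile> \<phi>"
      using assms(2) by blast
  qed simp
qed

end
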